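(* Let $X$ be a normed space, let $r\ge0$, let $\mathcal{I}$ be an ideal on $\mathbb{N}$, and let $\{\omega_t\}_{t\in\mathbb{N}}$ be a weighted sequence that is not $\mathcal{I}$-bounded. Then for every sequence $\{x_t\}_{t\in\mathbb{N}}$ in $X$, the set $(\omega_t,\mathcal{I})\text{-}\mathrm{LIM}^r x_t$ is either empty or a singleton.
   Context: A sequence $\{\omega_t\}_{t\in\mathbb{N}}$ of real numbers is a weighted sequence if there is $\beta>0$ with $\omega_t>\beta$ for all $t\in\mathbb{N}$. An ideal on $\mathbb{N}$ is a family $\mathcal{I}\subseteq\mathcal{P}(\mathbb{N})$ with $\varnothing\in\mathcal{I}$, closed under finite unions and under taking subsets. A weighted sequence $\{\omega_t\}$ is $\mathcal{I}$-bounded if there is $\mu>0$ with $\{t\in\mathbb{N}:\omega_t>\mu\}\in\mathcal{I}$. For $r\ge0$, $(\omega_t,\mathcal{I})\text{-}\mathrm{LIM}^r x_t$ is the set of all $x_*\in X$ such that $\{t\in\mathbb{N}:\omega_t\|x_t-x_*\|>r+\varepsilon\}\in\mathcal{I}$ for every $\varepsilon>0$. *)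

theory Defs
  imports Complex_Main
begin

definition weighted_seq :: "(nat \<Rightarrow> real) \<Rightarrow> bool" where
  "weighted_seq \<omega> \<longleftrightarrow> (\<exists>\<beta>>0. \<forall>t. \<omega> t > \<beta>)"

text \<open>Ideals need not be proper (\<open>UNIV\<close> may be a member) and need not contain the finite sets.\<close>

definition ideal_on_nat :: "nat set set \<Rightarrow> bool" where
  "ideal_on_nat \<I> \<longleftrightarrow>
     {} \<in> \<I> \<and>
     (\<forall>A\<in>\<I>. \<forall>B\<in>\<I>. A \<union> B \<in> \<I>) \<and>
     (\<forall>A\<in>\<I>. \<forall>B. B \<subseteq> A \<longrightarrow> B \<in> \<I>)"

definition ideal_bounded :: "nat set set \<Rightarrow> (nat \<Rightarrow> real) \<Rightarrow> bool" where
  "ideal_bounded \<I> \<omega> \<longleftrightarrow> (\<exists>\<mu>>0. {t. \<omega> t > \<mu>} \<in> \<I>)"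

definition rough_weighted_LIM ::
  "(nat \<Rightarrow> real) \<Rightarrow> nat set set \<Rightarrow> real \<Rightarrow> (nat \<Rightarrow> 'a::real_normed_vector) \<Rightarrow> 'a set" where
  "rough_weighted_LIM \<omega> \<I> r x = {l. \<forall>\<epsilon>>0. {t. \<omega> t * norm (x t - l) > r + \<epsilon>} \<in> \<I>}"

end

theory Submission
  imports Defs
begin

text \<open>
  Two distinct rough limits \<open>l\<close> and \<open>m\<close> force the weights to be bounded modulo the ideal. By the
  triangle inequality, \<open>x t\<close> cannot be close to both: the weighted distances of \<open>x t\<close> to \<open>l\<close> and
  to \<open>m\<close> add up to at least \<open>\<omega> t * norm (l - m)\<close>. So where \<open>\<omega> t\<close> is large, one of the two
  distances exceeds \<open>r + 1\<close>, and each of these events is negligible. For weights that are not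
  bounded modulo the ideal, the limit set therefore has at most one element.
\<close>

lemma distinct_rough_limits_imp_ideal_bounded:
  fixes x :: "nat \<Rightarrow> 'a::real_normed_vector"
  assumes r: "r \<ge> 0" and ideal: "ideal_on_nat \<I>" and pos: "\<And>t. \<omega> t \<ge> 0"
    and l: "l \<in> rough_weighted_LIM \<omega> \<I> r x"
    and m: "m \<in> rough_weighted_LIM \<omega> \<I> r x"
    and "l \<noteq> m"
  shows "ideal_bounded \<I> \<omega>"
proof -
  define d where "d = norm (l - m)"
  have d: "d > 0" using \<open>l \<noteq> m\<close> by (simp add: d_def)
  \<comment> \<open>The threshold beyond which \<open>\<omega> t * d\<close> exceeds \<open>2 * (r + 1)\<close>, so that both weighted distances
    cannot stay below \<open>r + 1\<close>.\<close>
  define \<mu> where "\<mu> = 2 * (r + 1) / d"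
  have \<mu>: "\<mu> > 0" using d r by (simp add: \<mu>_def)
  let ?far = "\<lambda>p. {t. \<omega> t * norm (x t - p) > r + 1}"
  have far: "?far l \<union> ?far m \<in> \<I>"
    using l m ideal by (simp add: rough_weighted_LIM_def ideal_on_nat_def)
  have "{t. \<omega> t > \<mu>} \<subseteq> ?far l \<union> ?far m"
  proof
    fix t assume "t \<in> {t. \<omega> t > \<mu>}"
    then have "2 * (r + 1) < \<omega> t * d"
      using d by (simp add: \<mu>_def divide_less_eq)
    also have "\<dots> \<le> \<omega> t * (norm (x t - l) + norm (x t - m))"
      using norm_triangle_ineq4[of "x t - m" "x t - l"]
      by (intro mult_left_mono pos) (simp add: d_def add.commute)
    finally show "t \<in> ?far l \<union> ?far m"
      by (auto simp: distrib_left)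
  qed
  with far ideal have "{t. \<omega> t > \<mu>} \<in> \<I>"
    unfolding ideal_on_nat_def by blast
  with \<mu> show ?thesis
    unfolding ideal_bounded_def by blast
qed

theorem lemma2p2:
  fixes r :: real
    and \<I> :: "nat set set"
    and \<omega> :: "nat \<Rightarrow> real"
    and x :: "nat \<Rightarrow> 'a::real_normed_vector"
  assumes "r \<ge> 0"
    and "ideal_on_nat \<I>"
    and "weighted_seq \<omega>"
    and "\<not> ideal_bounded \<I> \<omega>"
  shows "rough_weighted_LIM \<omega> \<I> r x = {} \<or> (\<exists>l. rough_weighted_LIM \<omega> \<I> r x = {l})"
proof -
  have pos: "\<omega> t \<ge> 0" for t
    using assms(3) unfolding weighted_seq_def by (meson less_imp_le less_trans)
  have "l = m" if "l \<in> rough_weighted_LIM \<omega> \<I> r x" "m \<in> rough_weighted_LIM \<omega> \<I> r x" for l m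
    using distinct_rough_limits_imp_ideal_bounded[OF assms(1,2) pos that] assms(4) by blast
  then show ?thesis by blast
qed

end
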